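(* (i) Let $\phi$ and $V_\phi$ be as described in the context, let $0<\rho<\lim_{x\to\infty}\phi(x)$, and let $X$ have the eCOM-Poisson$(\rho,\phi)$ distribution, i.e. $\mathbb{P}(X=n)=\frac{\rho^n}{V_\phi(n+1)}\frac{1}{Z(\rho,\phi)}$ for $n\in\mathbb{N}=\{0,1,2,\dots\}$, where $Z(\rho,\phi)=\sum_{k=0}^\infty\frac{\rho^k}{V_\phi(k+1)}$. Then the factorial moments $m_s=\mathbb{E}[X(X-1)\cdots(X-s+1)]$ satisfy $$m_s=\rho^s\,\frac{Z_s(\rho,\phi)}{Z(\rho,\phi)},\qquad s\in\mathbb{N},\qquad\text{where } Z_s(\rho,\phi)=\sum_{k=0}^\infty\frac{\Gamma(k+s+1)\,\rho^k}{k!\,V_\phi(k+s+1)}.$$ (ii) If, in addition, $\phi(x)=x^\delta$ with $\delta>0$, so that $X$ has the COM-Poisson distribution $\mathbb{P}(X=n)=\frac{\rho^n}{(n!)^\delta}\frac{1}{C_\delta(\rho)}$, $n\in\mathbb{N}$, with $\rho>0$ and $C_\delta(\rho)=\sum_{n=0}^\infty\frac{\rho^n}{(n!)^\delta}$, then $$m_s=\frac{\rho^s}{C_\delta(\rho)}\sum_{k=0}^\infty\frac{\rho^k}{k!}\,\bigl((k+s)!\bigr)^{1-\delta},\qquad s\in\mathbb{N}.$$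
   Context: The function $\phi:(0,\infty)\to(0,\infty)$ and the associated function $V_\phi:(0,\infty)\to(0,\infty)$ are of one of the following two types. (1) $\phi$ is a Bernstein function, i.e. $\phi\in\mathcal{C}^\infty$, $\phi\ge0$, and $(-1)^{n-1}\phi^{(n)}\ge0$ on $(0,\infty)$ for all integers $n\ge1$, and $V_\phi=W_\phi$ is the Bernstein-gamma function of $\phi$: the unique positive log-convex function on $(0,\infty)$ with $W_\phi(1)=1$ and $W_\phi(x+1)=\phi(x)W_\phi(x)$ for all $x>0$. (2) $\phi$ is eventually log-convex (there is $m\in\mathbb{R}$ such that $\log\phi$ is convex on $(m,\infty)\cap(0,\infty)$) with $\lim_{n\to\infty}\phi(n)/\phi(n+1)=1$, and $V_\phi(x)=\widetilde W_\phi(x)=\lim_{n\to\infty}\frac{\phi(n)\cdots\phi(1)\,(\phi(n))^x}{\phi(n+x)\phi(n-1+x)\cdots\phi(x)}$ for $x>0$; this satisfies $\widetilde W_\phi(1)=1$ and $\widetilde W_\phi(x+1)=\phi(x)\widetilde W_\phi(x)$. Only the values of $V_\phi$ at positive integers enter here, namely $V_\phi(n+1)=\prod_{k=1}^n\phi(k)$ for $n\in\mathbb{N}$ (empty product $=1$); for $\phi(x)=x^\delta$ with any $\delta>0$ this is used as the definition, $V_\phi(n+1)=(n!)^\delta$. The limit $\lim_{x\to\infty}\phi(x)$ may be $+\infty$, in which case $\rho$ is any positive number. For $s=0$ the empty product in $m_s$ is $1$. *)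

theory Defs
  imports "HOL-Probability.Probability"
begin

text \<open>
  Functions on $(0,\infty)$ are represented by functions of type \<open>real \<Rightarrow> real\<close> whose values on
  $(-\infty,0]$ are irrelevant. As \<open>{0<..}\<close> is open, iterated \<open>deriv\<close> at a positive point only
  depends on the values on \<open>{0<..}\<close>.
\<close>

definition bernstein_fun :: "(real \<Rightarrow> real) \<Rightarrow> bool" where
  "bernstein_fun \<phi> \<longleftrightarrow>
     (\<forall>x>0. \<phi> x \<ge> 0) \<and>
     (\<forall>n. \<forall>x>0. (deriv ^^ n) \<phi> field_differentiable (at x)) \<and>
     (\<forall>n\<ge>1. \<forall>x>0. (-1) ^ (n - 1) * (deriv ^^ n) \<phi> x \<ge> 0)"

text \<open>
  For a Bernstein function \<open>\<phi>\<close> these properties determine \<open>W\<close> uniquely on $(0,\infty)$.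
\<close>

definition bernstein_gamma :: "(real \<Rightarrow> real) \<Rightarrow> (real \<Rightarrow> real) \<Rightarrow> bool" where
  "bernstein_gamma \<phi> W \<longleftrightarrow>
     (\<forall>x>0. W x > 0) \<and>
     convex_on {0<..} (\<lambda>x. ln (W x)) \<and>
     W 1 = 1 \<and>
     (\<forall>x>0. W (x + 1) = \<phi> x * W x)"

definition eventually_log_convex :: "(real \<Rightarrow> real) \<Rightarrow> bool" where
  "eventually_log_convex \<phi> \<longleftrightarrow> (\<exists>m::real. convex_on ({m<..} \<inter> {0<..}) (\<lambda>x. ln (\<phi> x)))"

definition W_tilde :: "(real \<Rightarrow> real) \<Rightarrow> real \<Rightarrow> real" where
  "W_tilde \<phi> x =
     lim (\<lambda>n. (\<Prod>k=1..n. \<phi> (real k)) * \<phi> (real n) powr x / (\<Prod>k=0..n. \<phi> (real k + x)))"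

text \<open>
  The last disjunct is the convention for $\phi(x)=x^\delta$: for $\delta>1$ this function is of
  neither of the first two types, and \<open>V\<close> is then only prescribed at the positive integers.
\<close>

definition admissible :: "(real \<Rightarrow> real) \<Rightarrow> (real \<Rightarrow> real) \<Rightarrow> bool" where
  "admissible \<phi> V \<longleftrightarrow>
     \<phi> \<in> {0<..} \<rightarrow> {0<..} \<and> V \<in> {0<..} \<rightarrow> {0<..} \<and>
     (bernstein_fun \<phi> \<and> bernstein_gamma \<phi> V
      \<or> eventually_log_convex \<phi> \<and> (\<lambda>n. \<phi> (real n) / \<phi> (real (n + 1))) \<longlonglongrightarrow> 1 \<and>
          (\<forall>x>0. V x = W_tilde \<phi> x)
      \<or> (\<exists>\<delta>>0. (\<forall>x>0. \<phi> x = x powr \<delta>) \<and> (\<forall>n. V (real n + 1) = fact n powr \<delta>)))"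

definition Z_ecom :: "real \<Rightarrow> (real \<Rightarrow> real) \<Rightarrow> real" where
  "Z_ecom \<rho> V = (\<Sum>k. \<rho> ^ k / V (real k + 1))"

definition Z_ecom_term :: "nat \<Rightarrow> real \<Rightarrow> (real \<Rightarrow> real) \<Rightarrow> nat \<Rightarrow> real" where
  "Z_ecom_term s \<rho> V k = Gamma (real k + real s + 1) * \<rho> ^ k / (fact k * V (real k + real s + 1))"

definition Z_ecom_s :: "nat \<Rightarrow> real \<Rightarrow> (real \<Rightarrow> real) \<Rightarrow> real" where
  "Z_ecom_s s \<rho> V = (\<Sum>k. Z_ecom_term s \<rho> V k)"

definition ecom_poisson :: "'a measure \<Rightarrow> ('a \<Rightarrow> nat) \<Rightarrow> real \<Rightarrow> (real \<Rightarrow> real) \<Rightarrow> bool" where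
  "ecom_poisson M X \<rho> V \<longleftrightarrow>
     prob_space M \<and> X \<in> measurable M (count_space UNIV) \<and>
     (\<forall>n. measure M {\<omega> \<in> space M. X \<omega> = n} = \<rho> ^ n / V (real n + 1) * (1 / Z_ecom \<rho> V))"

definition C_com :: "real \<Rightarrow> real \<Rightarrow> real" where
  "C_com \<delta> \<rho> = (\<Sum>n. \<rho> ^ n / fact n powr \<delta>)"

definition com_poisson :: "'a measure \<Rightarrow> ('a \<Rightarrow> nat) \<Rightarrow> real \<Rightarrow> real \<Rightarrow> bool" where
  "com_poisson M X \<rho> \<delta> \<longleftrightarrow>
     prob_space M \<and> X \<in> measurable M (count_space UNIV) \<and>
     (\<forall>n. measure M {\<omega> \<in> space M. X \<omega> = n} = \<rho> ^ n / fact n powr \<delta> * (1 / C_com \<delta> \<rho>))"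

text \<open>The factors are real numbers, so there is no truncated subtraction.\<close>

definition falling_fact :: "nat \<Rightarrow> nat \<Rightarrow> real" where
  "falling_fact s n = (\<Prod>i<s. real n - real i)"

definition factorial_moment :: "'a measure \<Rightarrow> ('a \<Rightarrow> nat) \<Rightarrow> nat \<Rightarrow> real" where
  "factorial_moment M X s = (LINT \<omega>|M. falling_fact s (X \<omega>))"

end

theory Submission
  imports Defs
begin

text \<open>
  Everything rests on the values $V(n+1)=\prod_{k=1}^n\phi(k)$, which are the same for all three
  types of admissible pairs (\<open>admissible_nat_value\<close>). They turn the weight $\rho^n/V(n+1)$ into a
  sequence with successive quotients $\rho/\phi(n+1)$, which eventually stay below a number less than 1
  because $\rho<\lim\phi$. Hence the weights decay at least geometrically, and multiplying them
  by a polynomial in \<open>n\<close> does not destroy summability (\<open>summable_Z_ecom_term\<close>).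

  The expectation of a function of a random variable with values in the natural numbers is the
  series over its point masses (\<open>has_bochner_integral_nat_valued\<close>). For the falling factorial
  $n(n-1)\cdots(n-s+1)$ the first \<open>s\<close> terms of that series vanish, and the shift $n=k+s$ turns
  the falling factorial into $(k+s)!/k!$ and pulls out the factor $\rho^s$, which is the formula
  for $m_s$. If $\phi(x)=x^\delta$, the product is $(n!)^\delta$, and the second formula is the first
  with $(k+s)!/((k+s)!)^\delta=((k+s)!)^{1-\delta}$.
\<close>

section \<open>The values of \<open>V\<close> at the positive integers\<close>

lemma bernstein_gamma_nat_value:
  assumes "bernstein_gamma \<phi> W"
  shows "W (real n + 1) = (\<Prod>k=1..n. \<phi> (real k))"
proof (induction n)
  case 0
  then show ?case using assms by (simp add: bernstein_gamma_def)
next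
  case (Suc n)
  have "W ((real n + 1) + 1) = \<phi> (real n + 1) * W (real n + 1)"
    using assms unfolding bernstein_gamma_def by (metis add_nonneg_pos of_nat_0_le_iff zero_less_one)
  moreover have "real (Suc n) + 1 = (real n + 1) + 1" by simp
  ultimately show ?case using Suc by (simp add: mult.commute del: of_nat_Suc) (simp add: add.commute)
qed

text \<open>
  At $x=m+1$ the products in the definition of \<open>W_tilde\<close> telescope: what remains is
  $\prod_{k=1}^m\phi(k)$ times the \<open>m + 1\<close> quotients $\phi(n)/\phi(n+j)$, $1\le j\le m+1$, each of
  which tends to 1.
\<close>

lemma W_tilde_nat_value:
  assumes pos: "\<And>x. x > 0 \<Longrightarrow> \<phi> x > 0"
    and lim1: "(\<lambda>n. \<phi> (real n) / \<phi> (real (n + 1))) \<longlonglongrightarrow> 1"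
  shows "W_tilde \<phi> (real m + 1) = (\<Prod>k=1..m. \<phi> (real k))"
proof -
  have quot: "(\<lambda>n. \<phi> (real n) / \<phi> (real (n + j))) \<longlonglongrightarrow> 1" for j
  proof (induction j)
    case 0
    have "eventually (\<lambda>n. \<phi> (real n) / \<phi> (real (n + 0)) = 1) sequentially"
      using eventually_gt_at_top[of 0] by eventually_elim (use pos in \<open>simp add: less_imp_neq[symmetric]\<close>)
    then show ?case by (rule tendsto_eventually)
  next
    case (Suc j)
    have "(\<lambda>n. \<phi> (real (n + j)) / \<phi> (real (n + j + 1))) \<longlonglongrightarrow> 1"
      using LIMSEQ_ignore_initial_segment[OF lim1, of j] by simp
    from tendsto_mult[OF Suc this]
    have L: "(\<lambda>n. \<phi> (real n) / \<phi> (real (n + j)) * (\<phi> (real (n + j)) / \<phi> (real (n + j + 1))))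
        \<longlonglongrightarrow> 1" by simp
    have E: "eventually (\<lambda>n. \<phi> (real n) / \<phi> (real (n + j)) * (\<phi> (real (n + j)) / \<phi> (real (n + j + 1)))
        = \<phi> (real n) / \<phi> (real (n + Suc j))) sequentially"
      using eventually_gt_at_top[of 0]
    proof eventually_elim
      case (elim n)
      have "\<phi> (real (n + j)) \<noteq> 0" using pos[of "real (n + j)"] elim by simp
      then show ?case by simp
    qed
    show ?case using L tendsto_cong[OF E] by blast
  qed
  have prods: "(\<lambda>n. (\<Prod>k=1..m. \<phi> (real k)) * (\<Prod>j=1..m+1. \<phi> (real n) / \<phi> (real (n + j))))
      \<longlonglongrightarrow> (\<Prod>k=1..m. \<phi> (real k)) * (\<Prod>j=1..m+1. 1)"
    by (intro tendsto_intros quot)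
  have telescope: "(\<Prod>k=1..n. \<phi> (real k)) * \<phi> (real n) powr (real m + 1)
        / (\<Prod>k=0..n. \<phi> (real k + (real m + 1)))
      = (\<Prod>k=1..m. \<phi> (real k)) * (\<Prod>j=1..m+1. \<phi> (real n) / \<phi> (real (n + j)))"
    if "n > 0" for n
  proof -
    have nz: "(\<Prod>k\<in>A. \<phi> (real k)) \<noteq> 0" if "0 \<notin> A" "finite A" for A
    proof -
      have "\<phi> (real k) \<noteq> 0" if "k \<in> A" for k
        using pos[of "real k"] that \<open>0 \<notin> A\<close> by (cases k) auto
      then show ?thesis using \<open>finite A\<close> by simp
    qed
    (* Splitting the product over 1, ..., m + n + 1 at n and at m makes the cancellation valid for
       n \<le> m as well as for n > m. *)
    have "(\<Prod>k=1..n. \<phi> (real k)) * (\<Prod>k=n+1..n+(m+1). \<phi> (real k)) = (\<Prod>k=1..n+(m+1). \<phi> (real k))"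
      by (rule prod.ub_add_nat[symmetric]) simp
    moreover have "(\<Prod>k=1..m. \<phi> (real k)) * (\<Prod>k=m+1..m+(n+1). \<phi> (real k))
        = (\<Prod>k=1..m+(n+1). \<phi> (real k))"
      by (rule prod.ub_add_nat[symmetric]) simp
    ultimately have split: "(\<Prod>k=1..n. \<phi> (real k)) * (\<Prod>k=n+1..n+(m+1). \<phi> (real k))
       = (\<Prod>k=1..m. \<phi> (real k)) * (\<Prod>k=m+1..m+(n+1). \<phi> (real k))"
      by (metis add.left_commute)
    have sh1: "(\<Prod>k=0..n. \<phi> (real k + (real m + 1))) = (\<Prod>k=m+1..m+(n+1). \<phi> (real k))"
      by (rule prod.reindex_bij_witness[of _ "\<lambda>k. k - (m + 1)" "\<lambda>k. k + (m + 1)"])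
        (auto simp: ac_simps)
    have sh2: "(\<Prod>j=1..m+1. \<phi> (real (n + j))) = (\<Prod>k=n+1..n+(m+1). \<phi> (real k))"
      by (rule prod.reindex_bij_witness[of _ "\<lambda>k. k - n" "\<lambda>k. n + k"]) auto
    have pw: "\<phi> (real n) powr (real m + 1) = \<phi> (real n) ^ (m + 1)"
      using pos[of "real n"] that by (metis of_nat_0_less_iff of_nat_1 of_nat_add powr_realpow)
    have "(\<Prod>j=1..m+1. \<phi> (real n) / \<phi> (real (n + j)))
        = \<phi> (real n) ^ (m + 1) / (\<Prod>k=n+1..n+(m+1). \<phi> (real k))"
      unfolding sh2[symmetric] prod_dividef by simp
    moreover have "(\<Prod>k=n+1..n+(m+1). \<phi> (real k)) \<noteq> 0" "(\<Prod>k=m+1..m+(n+1). \<phi> (real k)) \<noteq> 0"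
      by (rule nz; simp)+
    moreover have "a * p / d = c * (p / b)" if "a * b = c * d" "b \<noteq> 0" "d \<noteq> 0" for a b c d p :: real
    proof -
      have "a = c * d / b" using that by (simp add: field_simps)
      then show ?thesis using that(3) by simp
    qed
    ultimately show ?thesis
      unfolding sh1 pw using split by metis
  qed
  have "eventually (\<lambda>n. (\<Prod>k=1..m. \<phi> (real k)) * (\<Prod>j=1..m+1. \<phi> (real n) / \<phi> (real (n + j)))
     = (\<Prod>k=1..n. \<phi> (real k)) * \<phi> (real n) powr (real m + 1)
        / (\<Prod>k=0..n. \<phi> (real k + (real m + 1)))) sequentially"
    using eventually_gt_at_top[of 0] by eventually_elim (use telescope in simp)
  from tendsto_cong[OF this] prods
  have "(\<lambda>n. (\<Prod>k=1..n. \<phi> (real k)) * \<phi> (real n) powr (real m + 1)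
        / (\<Prod>k=0..n. \<phi> (real k + (real m + 1)))) \<longlonglongrightarrow> (\<Prod>k=1..m. \<phi> (real k))"
    by simp
  then show ?thesis unfolding W_tilde_def by (rule limI)
qed

lemma prod_powr_fact:
  assumes "\<And>x. x > 0 \<Longrightarrow> \<phi> x = x powr \<delta>"
  shows "(\<Prod>k=1..n. \<phi> (real k)) = fact n powr \<delta>"
proof -
  have "(\<Prod>k=1..n. \<phi> (real k)) = (\<Prod>k=1..n. real k powr \<delta>)"
    using assms by (intro prod.cong) auto
  also have "\<dots> = (\<Prod>k=1..n. real k) powr \<delta>"
    by (rule prod_powr_distrib[symmetric])
  also have "(\<Prod>k=1..n. real k) = fact n" by (simp add: fact_prod)
  finally show ?thesis .
qed

lemma admissible_nat_value:
  assumes "admissible \<phi> V"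
  shows "V (real n + 1) = (\<Prod>k=1..n. \<phi> (real k))"
proof -
  have pos: "\<phi> x > 0" if "x > 0" for x
    using assms that unfolding admissible_def by auto
  from assms consider "bernstein_gamma \<phi> V"
    | "(\<lambda>n. \<phi> (real n) / \<phi> (real (n + 1))) \<longlonglongrightarrow> 1" "\<forall>x>0. V x = W_tilde \<phi> x"
    | \<delta> where "\<forall>x>0. \<phi> x = x powr \<delta>" "\<forall>n. V (real n + 1) = fact n powr \<delta>"
    unfolding admissible_def by blast
  then show ?thesis
  proof cases
    case 1
    then show ?thesis by (rule bernstein_gamma_nat_value)
  next
    case 2
    then show ?thesis using W_tilde_nat_value[of \<phi>, OF pos 2(1), of n] by simp
  next
    case 3
    then show ?thesis using prod_powr_fact[of \<phi> \<delta> n] by simp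
  qed
qed

section \<open>Summability\<close>

lemma Z_ecom_term_fact:
  "Z_ecom_term s \<rho> V k = fact (k + s) * \<rho> ^ k / (fact k * V (real (k + s) + 1))"
  using Gamma_fact[of "k + s", where 'a = real] by (simp add: Z_ecom_term_def ac_simps)

text \<open>
  The quotient of successive terms is $\frac{k+s+1}{k+1}\cdot\frac{\rho}{\phi(k+s+1)}$. Its first factor
  tends to 1, and the second is eventually at most $\rho/c$ for any \<open>c\<close> strictly between \<open>\<rho>\<close> and
  the limit of \<open>\<phi>\<close>, so that the ratio test applies. Working with such a \<open>c\<close> also covers an infinite
  limit.
\<close>

lemma summable_Z_ecom_term:
  assumes pos: "\<And>x. x > 0 \<Longrightarrow> \<phi> x > 0"
    and V: "\<And>n. V (real n + 1) = (\<Prod>k=1..n. \<phi> (real k))"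
    and lim: "((\<lambda>x. ereal (\<phi> x)) \<longlongrightarrow> L) at_top"
    and "0 < \<rho>" and "ereal \<rho> < L"
  shows "summable (Z_ecom_term s \<rho> V)"
proof -
  obtain c where c: "\<rho> < c" "ereal c < L"
    using ereal_dense2[OF \<open>ereal \<rho> < L\<close>] by auto
  have "eventually (\<lambda>x. c < \<phi> x) at_top"
    using order_tendstoD(1)[OF lim c(2)] by simp
  then have phi: "eventually (\<lambda>k. c < \<phi> (real (k + s + 1))) sequentially"
    by (rule eventually_compose_filterlim)
      real_asymp
  obtain q where q: "\<rho> / c < q" "q < 1"
    using dense[of "\<rho> / c" 1] c \<open>0 < \<rho>\<close> by auto
  have "(\<lambda>k. real (k + s + 1) / real (k + 1) * (\<rho> / c)) \<longlonglongrightarrow> 1 * (\<rho> / c)"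
    by (intro tendsto_mult tendsto_const) real_asymp
  then have "eventually (\<lambda>k. real (k + s + 1) / real (k + 1) * (\<rho> / c) < q) sequentially"
    using q(1) by (intro order_tendstoD(2)) auto
  with phi have "eventually (\<lambda>k. norm (Z_ecom_term s \<rho> V (Suc k)) \<le> q * norm (Z_ecom_term s \<rho> V k))
      sequentially"
  proof eventually_elim
    case (elim k)
    have Vpos: "V (real n + 1) > 0" for n
      unfolding V by (intro prod_pos) (auto intro: pos)
    have step: "V (real (Suc k + s) + 1) = V (real (k + s) + 1) * \<phi> (real (k + s + 1))"
      unfolding V by simp
    have nonneg: "Z_ecom_term s \<rho> V n \<ge> 0" for n
      unfolding Z_ecom_term_fact using Vpos[of "n + s"] \<open>0 < \<rho>\<close> by simp
    have "Z_ecom_term s \<rho> V (Suc k)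
        = real (k + s + 1) / real (k + 1) * (\<rho> / \<phi> (real (k + s + 1))) * Z_ecom_term s \<rho> V k"
      unfolding Z_ecom_term_fact step using Vpos[of "k + s"] by (simp add: field_simps)
    also have "\<dots> \<le> real (k + s + 1) / real (k + 1) * (\<rho> / c) * Z_ecom_term s \<rho> V k"
      using elim(1) c(1) \<open>0 < \<rho>\<close> by (intro mult_right_mono mult_left_mono divide_left_mono nonneg) auto
    also have "\<dots> \<le> q * Z_ecom_term s \<rho> V k"
      using elim(2) by (intro mult_right_mono nonneg) auto
    finally show ?case using nonneg by simp
  qed
  then obtain N where "\<forall>k\<ge>N. norm (Z_ecom_term s \<rho> V (Suc k)) \<le> q * norm (Z_ecom_term s \<rho> V k)"
    unfolding eventually_sequentially by blast
  then show ?thesis using q(2) by (intro summable_ratio_test[of q N]) auto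
qed

section \<open>Expectations as series over the point masses\<close>

text \<open>The law of \<open>X\<close> has the point masses as its density with respect to the counting measure.\<close>

lemma has_bochner_integral_nat_valued:
  fixes f :: "nat \<Rightarrow> real"
  assumes "prob_space M" and X: "X \<in> measurable M (count_space UNIV)"
    and summ: "summable (\<lambda>n. \<bar>measure M {\<omega> \<in> space M. X \<omega> = n} * f n\<bar>)"
  shows "has_bochner_integral M (\<lambda>\<omega>. f (X \<omega>)) (\<Sum>n. measure M {\<omega> \<in> space M. X \<omega> = n} * f n)"
proof -
  interpret prob_space M by fact
  let ?p = "\<lambda>n. measure M {\<omega> \<in> space M. X \<omega> = n}"
  have law: "distr M (count_space UNIV) X = density (count_space UNIV) (\<lambda>n. ennreal (?p n))"
  proof (rule measure_eqI_countable[of _ UNIV])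
    fix n :: nat
    have "emeasure (distr M (count_space UNIV) X) {n} = emeasure M (X -` {n} \<inter> space M)"
      using X by (simp add: emeasure_distr)
    also have "X -` {n} \<inter> space M = {\<omega> \<in> space M. X \<omega> = n}" by auto
    finally show "emeasure (distr M (count_space UNIV) X) {n}
        = emeasure (density (count_space UNIV) (\<lambda>n. ennreal (?p n))) {n}"
      by (simp add: emeasure_density nn_integral_count_space_indicator[symmetric]
        emeasure_eq_measure nn_integral_count_space_finite)
  qed auto
  have int: "integrable (count_space UNIV) (\<lambda>n. ?p n * f n)"
    using summ by (simp add: integrable_count_space_nat_iff)
  have "integrable (distr M (count_space UNIV) X) f"
    unfolding law using int by (subst integrable_density) auto
  then have "integrable M (\<lambda>\<omega>. f (X \<omega>))"
    using X by (simp add: integrable_distr_eq)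
  moreover have "(LINT \<omega>|M. f (X \<omega>)) = integral\<^sup>L (distr M (count_space UNIV) X) f"
    using X by (simp add: integral_distr)
  moreover have "\<dots> = (\<integral>n. ?p n * f n \<partial>count_space UNIV)"
    unfolding law by (subst integral_density) auto
  moreover have "\<dots> = (\<Sum>n. ?p n * f n)"
    by (rule integral_count_space_nat[OF int])
  ultimately show ?thesis by (simp add: has_bochner_integral_iff)
qed

lemma falling_fact_eq_0:
  "n < s \<Longrightarrow> falling_fact s n = 0"
  unfolding falling_fact_def by (rule prod_zero[of _]) auto

lemma falling_fact_add:
  "falling_fact s (k + s) = fact (k + s) / fact k"
proof (induction s arbitrary: k)
  case 0
  then show ?case by (simp add: falling_fact_def)
next
  case (Suc s)
  have "falling_fact (Suc s) (k + Suc s) = falling_fact s (Suc k + s) * real (Suc k)"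
    by (simp add: falling_fact_def)
  also have "\<dots> = fact (k + Suc s) / fact k"
    unfolding Suc.IH by simp
  finally show ?case .
qed

lemma ecom_poisson_factorial_moment:
  assumes "ecom_poisson M X \<rho> V" and summ: "summable (Z_ecom_term s \<rho> V)"
    and nonneg: "\<And>k. Z_ecom_term s \<rho> V k \<ge> 0"
  shows "has_bochner_integral M (\<lambda>\<omega>. falling_fact s (X \<omega>)) (\<rho> ^ s * (Z_ecom_s s \<rho> V / Z_ecom \<rho> V))"
proof -
  let ?p = "\<lambda>n. measure M {\<omega> \<in> space M. X \<omega> = n}"
  let ?g = "\<lambda>n. ?p n * falling_fact s n"
  from assms(1) have M: "prob_space M" "X \<in> measurable M (count_space UNIV)"
    and p: "?p n = \<rho> ^ n / V (real n + 1) * (1 / Z_ecom \<rho> V)" for n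
    unfolding ecom_poisson_def by auto
  have shift: "?g (k + s) = \<rho> ^ s / Z_ecom \<rho> V * Z_ecom_term s \<rho> V k" for k
    unfolding p falling_fact_add Z_ecom_term_fact by (simp add: power_add ac_simps)
  have "summable (\<lambda>k. \<bar>?g (k + s)\<bar>)"
    unfolding shift abs_mult using nonneg summ by (intro summable_mult) simp
  then have abs_summ: "summable (\<lambda>n. \<bar>?g n\<bar>)"
    by (subst (asm) summable_iff_shift)
  have "(\<Sum>n. ?g n) = (\<Sum>k. ?g (k + s)) + (\<Sum>n<s. ?g n)"
    by (rule suminf_split_initial_segment) (use abs_summ in \<open>rule summable_rabs_cancel\<close>)
  also have "(\<Sum>n<s. ?g n) = 0"
    by (intro sum.neutral) (simp add: falling_fact_eq_0)
  also have "(\<Sum>k. ?g (k + s)) = \<rho> ^ s * (Z_ecom_s s \<rho> V / Z_ecom \<rho> V)"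
    unfolding shift suminf_mult[OF summ] Z_ecom_s_def by simp
  finally show ?thesis
    using has_bochner_integral_nat_valued[OF M abs_summ] by simp
qed

section \<open>Factorial moments\<close>

theorem corollary7p2:
  fixes \<phi> V :: "real \<Rightarrow> real" and \<rho> :: real and L :: ereal
    and M :: "'a measure" and X :: "'a \<Rightarrow> nat"
  assumes "admissible \<phi> V"
    and "((\<lambda>x. ereal (\<phi> x)) \<longlongrightarrow> L) at_top"
    and "0 < \<rho>" and "ereal \<rho> < L"
    and "ecom_poisson M X \<rho> V"
  shows
    "(\<forall>s. integrable M (\<lambda>\<omega>. falling_fact s (X \<omega>)) \<and>
          summable (Z_ecom_term s \<rho> V) \<and>
          factorial_moment M X s = \<rho> ^ s * (Z_ecom_s s \<rho> V / Z_ecom \<rho> V)) \<and>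
     (\<forall>\<delta>>0. (\<forall>x>0. \<phi> x = x powr \<delta>) \<longrightarrow>
        com_poisson M X \<rho> \<delta> \<and>
        (\<forall>s. summable (\<lambda>k. \<rho> ^ k / fact k * fact (k + s) powr (1 - \<delta>)) \<and>
             factorial_moment M X s =
               \<rho> ^ s / C_com \<delta> \<rho> * (\<Sum>k. \<rho> ^ k / fact k * fact (k + s) powr (1 - \<delta>))))"
proof -
  have pos: "\<phi> x > 0" if "x > 0" for x
    using assms(1) that unfolding admissible_def by auto
  have V: "V (real n + 1) = (\<Prod>k=1..n. \<phi> (real k))" for n
    using admissible_nat_value[OF assms(1)] .
  have summ: "summable (Z_ecom_term s \<rho> V)" for s
    using summable_Z_ecom_term[OF pos V assms(2-4)] .
  have Vpos: "V (real n + 1) > 0" for n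
    unfolding V by (intro prod_pos) (auto intro: pos)
  have nonneg: "Z_ecom_term s \<rho> V k \<ge> 0" for s k
    unfolding Z_ecom_term_fact using Vpos[of "k + s"] assms(3) by simp
  have moment: "integrable M (\<lambda>\<omega>. falling_fact s (X \<omega>))"
    "factorial_moment M X s = \<rho> ^ s * (Z_ecom_s s \<rho> V / Z_ecom \<rho> V)" for s
    using ecom_poisson_factorial_moment[OF assms(5) summ nonneg, of s]
    by (simp_all add: has_bochner_integral_iff factorial_moment_def)
  have power: "com_poisson M X \<rho> \<delta> \<and>
      (\<forall>s. summable (\<lambda>k. \<rho> ^ k / fact k * fact (k + s) powr (1 - \<delta>)) \<and>
           factorial_moment M X s =
             \<rho> ^ s / C_com \<delta> \<rho> * (\<Sum>k. \<rho> ^ k / fact k * fact (k + s) powr (1 - \<delta>)))"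
    if "\<forall>x>0. \<phi> x = x powr \<delta>" for \<delta>
  proof -
    have Vd: "V (real n + 1) = fact n powr \<delta>" for n
      unfolding V using that by (intro prod_powr_fact) auto
    have C: "Z_ecom \<rho> V = C_com \<delta> \<rho>"
      unfolding Z_ecom_def C_com_def Vd ..
    have "com_poisson M X \<rho> \<delta>"
      using assms(5) unfolding ecom_poisson_def com_poisson_def Vd C .
    moreover have "Z_ecom_term s \<rho> V = (\<lambda>k. \<rho> ^ k / fact k * fact (k + s) powr (1 - \<delta>))" for s
      unfolding Z_ecom_term_fact Vd by (simp add: powr_diff fun_eq_iff)
    ultimately show ?thesis
      using summ moment(2) unfolding Z_ecom_s_def C by simp
  qed
  show ?thesis
    by (rule conjI; intro allI impI) (rule power, assumption | intro conjI summ moment)+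
qed

end
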